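(* Let $\Omega\subset\mathbb{R}^2$ be a bounded domain with boundary portions $\mathcal{D},\mathcal{N}$ separated by $\Gamma\neq\emptyset$, and let $R_0>0$, $\gamma\in[0,1/96]$ and $\kappa\in(0,1)$ be constants such that the following two conditions hold. Reifenberg flatness: for any $x_0\in\partial\Omega$ and $R\in(0,R_0]$ there is an orthonormal coordinate system (depending on $x_0,R$) in which $$\{y:x_0^1+\gamma R<y^1\}\cap B_R(x_0)\subset\Omega_R(x_0)\subset\{y:x_0^1-\gamma R<y^1\}\cap B_R(x_0),$$ where the superscript $1$ denotes the first coordinate. Separation: there is $y_0\in\partial\Omega$ with $\partial\Omega\cap B_{\kappa R_0}(y_0)\subset\mathcal{N}$; and for any $x_0\in\Gamma$ and $R\in(0,R_0]$ there is $z_0\in\mathcal{D}\cap B_R(x_0)$ with $B_{\kappa R}(z_0)\subset B_R(x_0)$ and $\partial\Omega\cap B_{\kappa R}(z_0)\subset\mathcal{D}$. Let $A^{\alpha\beta}$ be measurable strongly elliptic coefficients. Let $(G,\Pi)$ and $(G^*,\Pi^* )$ be Green functions for $\mathcal{L}$ and $\mathcal{L}^*$ in $\Omega$, respectively, satisfying $G(x,y)=G^*(y,x)^\top$ for all $x,y\in\Omega$ with $x\neq y$. Let $f,f^\alpha\in L^\infty(\Omega)^2$ and let $(u,p)\in W^{1,2}_{\mathcal{D}}(\Omega)^2\times L^2(\Omega)$ be a weak solution of $$\operatorname{div}u=0,\quad \mathcal{L}u+\nabla p=f+D_\alpha f^\alpha\ \text{ in }\Omega,\qquad \mathcal{B}u+p\nu=\nu_\alpha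 f^\alpha\ \text{ on }\mathcal{N},\qquad u=0\ \text{ on }\mathcal{D}.$$ Then for a.e. $y\in\Omega$, $$u(y)=-\int_\Omega G(y,\cdot)f\,dx+\int_\Omega D_\alpha G(y,\cdot)f^\alpha\,dx,$$ where $D_\alpha G(y,\cdot)$ denotes the derivative of $x\mapsto G(y,x)$.
   Context: Notation: $B_R(x)$ is the open Euclidean disk; $\Omega_R(x)=\Omega\cap B_R(x)$. Repeated indices are summed over $\{1,2\}$. Boundary: $\Omega\subset\mathbb{R}^2$ is a bounded domain; $\mathcal{D},\mathcal{N}\subset\partial\Omega$ are relatively open in $\partial\Omega$ with $\partial\Omega=\overline{\mathcal{D}}\cup\mathcal{N}$, $\mathcal{D}\cap\mathcal{N}=\emptyset$, $\Gamma=\overline{\mathcal{D}}\cap\overline{\mathcal{N}}\neq\emptyset$. $R_0>0$ is a fixed constant. Function spaces: $C^\infty_{\mathcal{D}}(\Omega)$ is the set of restrictions to $\Omega$ of infinitely differentiable compactly supported functions on $\mathbb{R}^2$ vanishing in a neighborhood of $\overline{\mathcal{D}}$; for $q\in[1,\infty]$, $W^{1,q}_{\mathcal{D}}(\Omega)$ is its closure in $W^{1,q}(\Omega)$. Operators: $\mathcal{L}u=D_\alpha(A^{\alpha\beta}D_\beta u)$, where $A^{\alpha\beta}=A^{\alpha\beta}(x)$ are measurable $2\times2$ real matrix-valued functions on $\mathbb{R}^2$ with, for some $\lambda\in(0,1]$, $|A^{\alpha\beta}|\le\lambda^{-1}$ and $\lambda|\xi|^2\le A^{\alpha\beta}_{ij}\xi^\beta_j\xi^\alpha_i$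 for all $\xi\in\mathbb{R}^{2\times2}$. The adjoint is $\mathcal{L}^*u=D_\alpha((A^{\beta\alpha})^\top D_\beta u)$. Conormal derivatives: $\mathcal{B}u=\nu_\alpha A^{\alpha\beta}D_\beta u$, $\mathcal{B}^*u=\nu_\alpha(A^{\beta\alpha})^\top D_\beta u$ (they enter only through weak formulations). Weak solutions: $(u,p)\in W^{1,2}_{\mathcal{D}}(\Omega)^2\times L^2(\Omega)$ is a weak solution of $\operatorname{div}u=g$, $\mathcal{L}u+\nabla p=f+D_\alpha f^\alpha$ in $\Omega$, $\mathcal{B}u+p\nu=\nu_\alpha f^\alpha$ on $\mathcal{N}$, $u=0$ on $\mathcal{D}$ if $\operatorname{div}u=g$ a.e. and $$\int_\Omega A^{\alpha\beta}D_\beta u\cdot D_\alpha\varphi\,dx+\int_\Omega p\operatorname{div}\varphi\,dx=-\int_\Omega f\cdot\varphi\,dx+\int_\Omega f^\alpha\cdot D_\alpha\varphi\,dx$$ for all $\varphi\in C^\infty_{\mathcal{D}}(\Omega)^2$. For the adjoint problem (with $\mathcal{L}^*,\mathcal{B}^*$) the first integral is replaced by $\int_\Omega A^{\alpha\beta}D_\beta\varphi\cdot D_\alpha u\,dx$. Green function: $(G,\Pi)$ is a Green function for $\mathcal{L}$ in $\Omega$ if (a) for every $y\in\Omega$, $G(\cdot,y)\in W^{1,1}_{\mathcal{D}}(\Omega)^{2\times2}$ and $\Pi(\cdot,y)\in L^1(\Omega)^{1\times2}$; (b) for every $y\in\Omega$ and $k\in\{1,2\}$, writing $G_{\cdot k}$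 for the $k$th column, $\operatorname{div}G_{\cdot k}(\cdot,y)=0$ a.e. in $\Omega$, and $$\int_\Omega A^{\alpha\beta}D_\beta G_{\cdot k}(\cdot,y)\cdot D_\alpha\varphi\,dx+\int_\Omega\Pi_k(\cdot,y)\operatorname{div}\varphi\,dx=\varphi_k(y)$$ for all $\varphi\in W^{1,\infty}_{\mathcal{D}}(\Omega)^2\cap C(\Omega)^2$; (c) if $(u,p)\in W^{1,2}_{\mathcal{D}}(\Omega)^2\times L^2(\Omega)$ is a weak solution of the adjoint problem with $f,f^\alpha\in L^\infty(\Omega)^2$, $g\in L^\infty(\Omega)$, then for a.e. $y\in\Omega$, $$u(y)=-\int_\Omega G(\cdot,y)^\top f\,dx+\int_\Omega D_\alpha G(\cdot,y)^\top f^\alpha\,dx+\int_\Omega\Pi(\cdot,y)^\top g\,dx.$$ A Green function for $\mathcal{L}^*$ is defined in the same way with $A^{\alpha\beta}$ replaced by $(A^{\beta\alpha})^\top$ throughout (so that the roles of $\mathcal{L}$ and $\mathcal{L}^*$ are exchanged). *)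

theory Defs
  imports "HOL-Analysis.Analysis" "HOL-Probability.Essential_Supremum"
begin

text \<open>
  Conventions. Functions on a domain are total functions on \<open>real^2\<close>; every notion below refers
  to \<open>lebesgue_on \<Omega>\<close> (or to points of \<open>\<Omega>\<close>), so values off \<open>\<Omega>\<close> are irrelevant, and elements of the
  Lebesgue and Sobolev spaces are representatives of the usual classes modulo null sets.
\<close>

section \<open>Smooth functions\<close>

definition partial_deriv :: "2 \<Rightarrow> (real^2 \<Rightarrow> real) \<Rightarrow> real^2 \<Rightarrow> real" where
  "partial_deriv i \<phi> x = frechet_derivative \<phi> (at x) (axis i 1)"

fun k_times_diff :: "nat \<Rightarrow> (real^2 \<Rightarrow> real) \<Rightarrow> bool" where
  "k_times_diff 0 \<phi> \<longleftrightarrow> continuous_on UNIV \<phi>"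
| "k_times_diff (Suc k) \<phi> \<longleftrightarrow>
     \<phi> differentiable_on UNIV \<and> (\<forall>i. k_times_diff k (partial_deriv i \<phi>))"

definition Cc_inf :: "(real^2 \<Rightarrow> real) set" where
  "Cc_inf = {\<phi>. (\<forall>k. k_times_diff k \<phi>) \<and> compact (closure {x. \<phi> x \<noteq> 0})}"

definition CD_inf :: "(real^2) set \<Rightarrow> (real^2) set \<Rightarrow> (real^2 \<Rightarrow> real) set" where
  "CD_inf \<Omega> D = {u. \<exists>\<phi>\<in>Cc_inf. (\<exists>U. open U \<and> closure D \<subseteq> U \<and> (\<forall>x\<in>U. \<phi> x = 0)) \<and>
     (\<forall>x\<in>\<Omega>. u x = \<phi> x)}"

section \<open>Lebesgue and Sobolev spaces, exponents in the extended interval from 1 to infinity\<close>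

definition Lq :: "ereal \<Rightarrow> (real^2) set \<Rightarrow> (real^2 \<Rightarrow> real) set" where
  "Lq q \<Omega> = {u. u \<in> borel_measurable (lebesgue_on \<Omega>) \<and>
     (if q = \<infinity> then esssup (lebesgue_on \<Omega>) (\<lambda>x. ereal \<bar>u x\<bar>) < \<infinity>
      else integrable (lebesgue_on \<Omega>) (\<lambda>x. \<bar>u x\<bar> powr real_of_ereal q))}"

definition Lq_norm :: "ereal \<Rightarrow> (real^2) set \<Rightarrow> (real^2 \<Rightarrow> real) \<Rightarrow> real" where
  "Lq_norm q \<Omega> u =
     (if q = \<infinity> then real_of_ereal (esssup (lebesgue_on \<Omega>) (\<lambda>x. ereal \<bar>u x\<bar>))
      else (LINT x|lebesgue_on \<Omega>. \<bar>u x\<bar> powr real_of_ereal q) powr (1 / real_of_ereal q))"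

definition has_weak_deriv ::
    "(real^2) set \<Rightarrow> 2 \<Rightarrow> (real^2 \<Rightarrow> real) \<Rightarrow> (real^2 \<Rightarrow> real) \<Rightarrow> bool" where
  "has_weak_deriv \<Omega> i u v \<longleftrightarrow>
     (\<forall>K. compact K \<and> K \<subseteq> \<Omega> \<longrightarrow> integrable (lebesgue_on K) u \<and> integrable (lebesgue_on K) v) \<and>
     (\<forall>\<phi>\<in>Cc_inf. closure {x. \<phi> x \<noteq> 0} \<subseteq> \<Omega> \<longrightarrow>
        (LINT x|lebesgue_on \<Omega>. u x * partial_deriv i \<phi> x) = - (LINT x|lebesgue_on \<Omega>. v x * \<phi> x))"

text \<open>A representative of the weak derivative, which is unique up to null sets when it exists.\<close>

definition wD :: "(real^2) set \<Rightarrow> 2 \<Rightarrow> (real^2 \<Rightarrow> real) \<Rightarrow> real^2 \<Rightarrow> real" where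
  "wD \<Omega> i u = (SOME v. has_weak_deriv \<Omega> i u v)"

definition W1 :: "ereal \<Rightarrow> (real^2) set \<Rightarrow> (real^2 \<Rightarrow> real) set" where
  "W1 q \<Omega> = {u \<in> Lq q \<Omega>. \<forall>i. \<exists>v \<in> Lq q \<Omega>. has_weak_deriv \<Omega> i u v}"

definition W1_norm :: "ereal \<Rightarrow> (real^2) set \<Rightarrow> (real^2 \<Rightarrow> real) \<Rightarrow> real" where
  "W1_norm q \<Omega> u = Lq_norm q \<Omega> u + (\<Sum>i\<in>UNIV. Lq_norm q \<Omega> (wD \<Omega> i u))"

definition W1D :: "ereal \<Rightarrow> (real^2) set \<Rightarrow> (real^2) set \<Rightarrow> (real^2 \<Rightarrow> real) set" where
  "W1D q \<Omega> D = {u \<in> W1 q \<Omega>. \<forall>\<epsilon>>0. \<exists>\<phi> \<in> CD_inf \<Omega> D. W1_norm q \<Omega> (\<lambda>x. u x - \<phi> x) < \<epsilon>}"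

definition vec_of :: "(real^2 \<Rightarrow> real) set \<Rightarrow> (real^2 \<Rightarrow> real^2) set" where
  "vec_of X = {u. \<forall>i. (\<lambda>x. u x $ i) \<in> X}"

definition mat_of :: "(real^2 \<Rightarrow> real) set \<Rightarrow> (real^2 \<Rightarrow> real^2^2) set" where
  "mat_of X = {M. \<forall>i j. (\<lambda>x. M x $ i $ j) \<in> X}"

definition wD_vec :: "(real^2) set \<Rightarrow> 2 \<Rightarrow> (real^2 \<Rightarrow> real^2) \<Rightarrow> real^2 \<Rightarrow> real^2" where
  "wD_vec \<Omega> \<alpha> u x = (\<chi> i. wD \<Omega> \<alpha> (\<lambda>z. u z $ i) x)"

definition wD_mat :: "(real^2) set \<Rightarrow> 2 \<Rightarrow> (real^2 \<Rightarrow> real^2^2) \<Rightarrow> real^2 \<Rightarrow> real^2^2" where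
  "wD_mat \<Omega> \<alpha> M x = (\<chi> i j. wD \<Omega> \<alpha> (\<lambda>z. M z $ i $ j) x)"

definition wdiv :: "(real^2) set \<Rightarrow> (real^2 \<Rightarrow> real^2) \<Rightarrow> real^2 \<Rightarrow> real" where
  "wdiv \<Omega> u x = (\<Sum>i\<in>UNIV. wD \<Omega> i (\<lambda>z. u z $ i) x)"

section \<open>Operators and weak solutions\<close>

text \<open>\<open>A \<alpha> \<beta> x\<close> is the matrix of the coefficient with upper indices \<open>\<alpha>\<close>, \<open>\<beta>\<close>;
  the norm on \<open>real^2^2\<close> is the Euclidean one.\<close>

type_synonym coeffs = "2 \<Rightarrow> 2 \<Rightarrow> real^2 \<Rightarrow> real^2^2"

definition strongly_elliptic :: "real \<Rightarrow> coeffs \<Rightarrow> bool" where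
  "strongly_elliptic l A \<longleftrightarrow>
     (\<forall>\<alpha> \<beta>. A \<alpha> \<beta> \<in> borel_measurable lebesgue) \<and>
     (\<forall>\<alpha> \<beta> x. norm (A \<alpha> \<beta> x) \<le> inverse l) \<and>
     (\<forall>x. \<forall>\<xi> :: real^2^2. l * (norm \<xi>)\<^sup>2 \<le>
        (\<Sum>\<alpha>\<in>UNIV. \<Sum>\<beta>\<in>UNIV. \<Sum>i\<in>UNIV. \<Sum>j\<in>UNIV. A \<alpha> \<beta> x $ i $ j * \<xi> $ \<beta> $ j * \<xi> $ \<alpha> $ i))"

definition adj_coeffs :: "coeffs \<Rightarrow> coeffs" where
  "adj_coeffs A = (\<lambda>\<alpha> \<beta> x. transpose (A \<beta> \<alpha> x))"

definition bform ::
    "coeffs \<Rightarrow> (real^2) set \<Rightarrow> (real^2 \<Rightarrow> real^2) \<Rightarrow> (real^2 \<Rightarrow> real^2) \<Rightarrow> real" where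
  "bform A \<Omega> u \<phi> = (LINT x|lebesgue_on \<Omega>.
     (\<Sum>\<alpha>\<in>UNIV. \<Sum>\<beta>\<in>UNIV. (A \<alpha> \<beta> x *v wD_vec \<Omega> \<beta> u x) \<bullet> wD_vec \<Omega> \<alpha> \<phi> x))"

text \<open>\<open>F \<alpha>\<close> is the vector field whose \<open>\<alpha>\<close>-derivative appears in the right-hand side.\<close>

definition weak_solution ::
    "(real^2) set \<Rightarrow> (real^2) set \<Rightarrow> coeffs \<Rightarrow> (real^2 \<Rightarrow> real^2) \<Rightarrow> (2 \<Rightarrow> real^2 \<Rightarrow> real^2) \<Rightarrow>
     (real^2 \<Rightarrow> real) \<Rightarrow> (real^2 \<Rightarrow> real^2) \<Rightarrow> (real^2 \<Rightarrow> real) \<Rightarrow> bool" where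
  "weak_solution \<Omega> D A f F g u p \<longleftrightarrow>
     u \<in> vec_of (W1D 2 \<Omega> D) \<and> p \<in> Lq 2 \<Omega> \<and>
     (AE x in lebesgue_on \<Omega>. wdiv \<Omega> u x = g x) \<and>
     (\<forall>\<phi> \<in> vec_of (CD_inf \<Omega> D).
        bform A \<Omega> u \<phi> + (LINT x|lebesgue_on \<Omega>. p x * wdiv \<Omega> \<phi> x) =
        - (LINT x|lebesgue_on \<Omega>. f x \<bullet> \<phi> x)
        + (LINT x|lebesgue_on \<Omega>. (\<Sum>\<alpha>\<in>UNIV. F \<alpha> x \<bullet> wD_vec \<Omega> \<alpha> \<phi> x)))"

definition adjoint_weak_solution ::
    "(real^2) set \<Rightarrow> (real^2) set \<Rightarrow> coeffs \<Rightarrow> (real^2 \<Rightarrow> real^2) \<Rightarrow> (2 \<Rightarrow> real^2 \<Rightarrow> real^2) \<Rightarrow>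
     (real^2 \<Rightarrow> real) \<Rightarrow> (real^2 \<Rightarrow> real^2) \<Rightarrow> (real^2 \<Rightarrow> real) \<Rightarrow> bool" where
  "adjoint_weak_solution \<Omega> D A f F g u p \<longleftrightarrow>
     u \<in> vec_of (W1D 2 \<Omega> D) \<and> p \<in> Lq 2 \<Omega> \<and>
     (AE x in lebesgue_on \<Omega>. wdiv \<Omega> u x = g x) \<and>
     (\<forall>\<phi> \<in> vec_of (CD_inf \<Omega> D).
        bform A \<Omega> \<phi> u + (LINT x|lebesgue_on \<Omega>. p x * wdiv \<Omega> \<phi> x) =
        - (LINT x|lebesgue_on \<Omega>. f x \<bullet> \<phi> x)
        + (LINT x|lebesgue_on \<Omega>. (\<Sum>\<alpha>\<in>UNIV. F \<alpha> x \<bullet> wD_vec \<Omega> \<alpha> \<phi> x)))"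

section \<open>Green functions\<close>

text \<open>The arguments of \<open>G x y\<close> and \<open>P x y\<close> are the variable \<open>x\<close> and the pole \<open>y\<close>. The pressure
  part \<open>P\<close> takes values in 1 by 2 matrices, represented as vectors.\<close>

definition green_function ::
    "(real^2) set \<Rightarrow> (real^2) set \<Rightarrow> coeffs \<Rightarrow> (real^2 \<Rightarrow> real^2 \<Rightarrow> real^2^2) \<Rightarrow>
     (real^2 \<Rightarrow> real^2 \<Rightarrow> real^2) \<Rightarrow> bool" where
  "green_function \<Omega> D A G P \<longleftrightarrow>
     (\<forall>y\<in>\<Omega>. (\<lambda>x. G x y) \<in> mat_of (W1D 1 \<Omega> D) \<and> (\<lambda>x. P x y) \<in> vec_of (Lq 1 \<Omega>)) \<and>
     (\<forall>y\<in>\<Omega>. \<forall>k.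
        (AE x in lebesgue_on \<Omega>. wdiv \<Omega> (\<lambda>z. column k (G z y)) x = 0) \<and>
        (\<forall>\<phi> \<in> vec_of (W1D \<infinity> \<Omega> D). continuous_on \<Omega> \<phi> \<longrightarrow>
           bform A \<Omega> (\<lambda>z. column k (G z y)) \<phi>
           + (LINT x|lebesgue_on \<Omega>. P x y $ k * wdiv \<Omega> \<phi> x) = \<phi> y $ k)) \<and>
     (\<forall>f F g u p.
        f \<in> vec_of (Lq \<infinity> \<Omega>) \<and> (\<forall>\<alpha>. F \<alpha> \<in> vec_of (Lq \<infinity> \<Omega>)) \<and> g \<in> Lq \<infinity> \<Omega> \<and>
        adjoint_weak_solution \<Omega> D A f F g u p \<longrightarrow>
        (AE y in lebesgue_on \<Omega>.
           u y = - (LINT x|lebesgue_on \<Omega>. transpose (G x y) *v f x)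
                 + (LINT x|lebesgue_on \<Omega>.
                      (\<Sum>\<alpha>\<in>UNIV. transpose (wD_mat \<Omega> \<alpha> (\<lambda>z. G z y) x) *v F \<alpha> x))
                 + (LINT x|lebesgue_on \<Omega>. g x *\<^sub>R P x y)))"

section \<open>Geometry of the domain\<close>

definition bounded_domain :: "(real^2) set \<Rightarrow> bool" where
  "bounded_domain \<Omega> \<longleftrightarrow> open \<Omega> \<and> connected \<Omega> \<and> \<Omega> \<noteq> {} \<and> bounded \<Omega>"

definition boundary_portions :: "(real^2) set \<Rightarrow> (real^2) set \<Rightarrow> (real^2) set \<Rightarrow> bool" where
  "boundary_portions \<Omega> D N \<longleftrightarrow>
     openin (top_of_set (frontier \<Omega>)) D \<and> openin (top_of_set (frontier \<Omega>)) N \<and>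
     frontier \<Omega> = closure D \<union> N \<and> D \<inter> N = {} \<and> closure D \<inter> closure N \<noteq> {}"

text \<open>The orthonormal coordinates of a point \<open>y\<close> are the components of \<open>T y\<close>.\<close>

definition reifenberg_flat :: "(real^2) set \<Rightarrow> real \<Rightarrow> real \<Rightarrow> bool" where
  "reifenberg_flat \<Omega> R0 \<gamma> \<longleftrightarrow>
     (\<forall>x0 \<in> frontier \<Omega>. \<forall>R \<in> {0<..R0}. \<exists>T :: real^2 \<Rightarrow> real^2. orthogonal_transformation T \<and>
        {y. T x0 $ 1 + \<gamma> * R < T y $ 1} \<inter> ball x0 R \<subseteq> \<Omega> \<inter> ball x0 R \<and>
        \<Omega> \<inter> ball x0 R \<subseteq> {y. T x0 $ 1 - \<gamma> * R < T y $ 1} \<inter> ball x0 R)"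

definition separation_condition ::
    "(real^2) set \<Rightarrow> (real^2) set \<Rightarrow> (real^2) set \<Rightarrow> real \<Rightarrow> real \<Rightarrow> bool" where
  "separation_condition \<Omega> D N R0 \<kappa> \<longleftrightarrow>
     (\<exists>y0 \<in> frontier \<Omega>. frontier \<Omega> \<inter> ball y0 (\<kappa> * R0) \<subseteq> N) \<and>
     (\<forall>x0 \<in> closure D \<inter> closure N. \<forall>R \<in> {0<..R0}. \<exists>z0 \<in> D \<inter> ball x0 R.
        ball z0 (\<kappa> * R) \<subseteq> ball x0 R \<and> frontier \<Omega> \<inter> ball z0 (\<kappa> * R) \<subseteq> D)"

end

theory Submission
  imports Defs
begin

text \<open>
  The representation of \<open>u\<close> is the representation formula contained in the definition of the Green
  function \<open>(G', P')\<close> of the adjoint operator, rewritten by the symmetry relation. Two facts carry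
  the argument. Transposing the coefficients twice changes nothing, so the adjoint problem of the
  adjoint operator is the original problem (\<open>adjoint_weak_solution_adj_coeffs\<close>); hence \<open>(u, p)\<close> is an
  admissible pair in the formula for \<open>(G', P')\<close>, and the pressure term there vanishes because
  \<open>div u = 0\<close>. The formula obtained involves the transposes of \<open>G' x y\<close> and of its derivatives
  in \<open>x\<close>. Symmetry identifies the former with \<open>G y x\<close> for every \<open>x \<noteq> y\<close>. It carries over to the
  derivatives in \<open>x\<close> because being a weak derivative of a function depends only on its class
  modulo null sets, so two functions on \<open>\<Omega>\<close> that differ at most at the point \<open>y\<close> have the same weak derivatives, and even the same chosen representative
  (\<open>wD_cong_AE\<close>).
\<close>

text \<open>
  Measurability passes between functions that agree almost everywhere because Lebesgue measure is
  complete. Hence both sides of the integral congruences below are integrable together; when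
  neither is, both integrals take the default value 0.
\<close>

lemma borel_measurable_lebesgue_on_cong_AE:
  fixes f g :: "'a::euclidean_space \<Rightarrow> 'b::euclidean_space"
  assumes S: "S \<in> sets lebesgue" and eq: "AE x in lebesgue_on S. f x = g x"
  shows "f \<in> borel_measurable (lebesgue_on S) \<longleftrightarrow> g \<in> borel_measurable (lebesgue_on S)"
proof -
  have imp: "g' \<in> borel_measurable (lebesgue_on S)"
    if f': "f' \<in> borel_measurable (lebesgue_on S)" and eq': "AE x in lebesgue_on S. f' x = g' x"
    for f' g' :: "'a \<Rightarrow> 'b"
  proof -
    let ?f = "\<lambda>x. if x \<in> S then f' x else 0" and ?g = "\<lambda>x. if x \<in> S then g' x else 0"
    have "?f \<in> borel_measurable lebesgue"
      using f' S by (simp add: borel_measurable_if)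
    moreover have "AE x in lebesgue. ?f x = ?g x"
      using eq' S by (subst (asm) AE_restrict_space_iff) auto
    ultimately have "?g \<in> borel_measurable lebesgue"
      by (rule borel_measurable_AE)
    then show ?thesis
      using S by (simp add: borel_measurable_if)
  qed
  show ?thesis
  proof
    show "g \<in> borel_measurable (lebesgue_on S)" if "f \<in> borel_measurable (lebesgue_on S)"
      using imp[OF that eq] .
    show "f \<in> borel_measurable (lebesgue_on S)" if "g \<in> borel_measurable (lebesgue_on S)"
      using imp[OF that] eq by (simp add: eq_commute[of "g _"])
  qed
qed

lemma integrable_lebesgue_on_cong_AE:
  fixes f g :: "'a::euclidean_space \<Rightarrow> 'b::euclidean_space"
  assumes "S \<in> sets lebesgue" and "AE x in lebesgue_on S. f x = g x"
  shows "integrable (lebesgue_on S) f \<longleftrightarrow> integrable (lebesgue_on S) g"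
  using borel_measurable_lebesgue_on_cong_AE[OF assms] integrable_cong_AE[OF _ _ assms(2)]
  by (blast dest: borel_measurable_integrable)

lemma integral_lebesgue_on_cong_AE:
  fixes f g :: "'a::euclidean_space \<Rightarrow> 'b::euclidean_space"
  assumes "S \<in> sets lebesgue" and "AE x in lebesgue_on S. f x = g x"
  shows "integral\<^sup>L (lebesgue_on S) f = integral\<^sup>L (lebesgue_on S) g"
proof (cases "integrable (lebesgue_on S) f")
  case True
  then show ?thesis
    using integrable_lebesgue_on_cong_AE[OF assms] assms(2)
    by (intro integral_cong_AE borel_measurable_integrable) auto
next
  case False
  then show ?thesis
    using integrable_lebesgue_on_cong_AE[OF assms] by (simp add: not_integrable_integral_eq)
qed

lemma has_weak_deriv_cong_AE:
  assumes \<Omega>: "\<Omega> \<in> sets lebesgue" and eq: "AE x in lebesgue_on \<Omega>. u x = u' x"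
  shows "has_weak_deriv \<Omega> i u v \<longleftrightarrow> has_weak_deriv \<Omega> i u' v"
proof -
  have "integrable (lebesgue_on K) u \<longleftrightarrow> integrable (lebesgue_on K) u'"
    if "compact K" "K \<subseteq> \<Omega>" for K
  proof (rule integrable_lebesgue_on_cong_AE)
    show K: "K \<in> sets lebesgue"
      using that(1) by (simp add: borel_compact)
    show "AE x in lebesgue_on K. u x = u' x"
      using eq \<Omega> K that(2) by (auto simp: AE_restrict_space_iff)
  qed
  moreover have "(LINT x|lebesgue_on \<Omega>. u x * h x) = (LINT x|lebesgue_on \<Omega>. u' x * h x)" for h
    using eq by (intro integral_lebesgue_on_cong_AE[OF \<Omega>]) auto
  ultimately show ?thesis
    unfolding has_weak_deriv_def by auto
qed

text \<open>
  The representative of the weak derivative is chosen from a set that depends only on the class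
  of the function; so the two representatives are equal everywhere, not only almost everywhere.
\<close>

lemma wD_cong_AE:
  assumes "\<Omega> \<in> sets lebesgue" and "AE x in lebesgue_on \<Omega>. u x = u' x"
  shows "wD \<Omega> i u = wD \<Omega> i u'"
  unfolding wD_def by (intro arg_cong[of _ _ Eps] ext has_weak_deriv_cong_AE assms)

lemma wD_mat_transpose_cong_AE:
  assumes \<Omega>: "\<Omega> \<in> sets lebesgue" and eq: "AE x in lebesgue_on \<Omega>. M x = transpose (M' x)"
  shows "wD_mat \<Omega> \<alpha> M x = transpose (wD_mat \<Omega> \<alpha> M' x)"
proof -
  have "wD \<Omega> \<alpha> (\<lambda>z. M z $ i $ j) = wD \<Omega> \<alpha> (\<lambda>z. M' z $ j $ i)" for i j
    using eq by (intro wD_cong_AE[OF \<Omega>]) (auto simp: transpose_def)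
  then show ?thesis
    by (simp add: wD_mat_def transpose_def)
qed

lemma bform_adj_coeffs: "bform (adj_coeffs A) \<Omega> \<phi> u = bform A \<Omega> u \<phi>"
proof -
  have "(transpose M *v a) \<bullet> b = (M *v b) \<bullet> a" for M :: "real^2^2" and a b
    by (metis dot_lmul_matrix inner_commute transpose_matrix_vector)
  then show ?thesis
    unfolding bform_def adj_coeffs_def by (subst sum.swap) simp
qed

lemma adjoint_weak_solution_adj_coeffs:
  "adjoint_weak_solution \<Omega> D (adj_coeffs A) f F g u p \<longleftrightarrow> weak_solution \<Omega> D A f F g u p"
  unfolding adjoint_weak_solution_def weak_solution_def bform_adj_coeffs ..

theorem mainTheorem2:
  fixes \<Omega> D N :: "(real^2) set"
    and R0 \<gamma> \<kappa> l :: real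
    and A :: coeffs
    and G G' :: "real^2 \<Rightarrow> real^2 \<Rightarrow> real^2^2"
    and P P' :: "real^2 \<Rightarrow> real^2 \<Rightarrow> real^2"
    and f u :: "real^2 \<Rightarrow> real^2"
    and F :: "2 \<Rightarrow> real^2 \<Rightarrow> real^2"
    and p :: "real^2 \<Rightarrow> real"
  assumes "bounded_domain \<Omega>" and "boundary_portions \<Omega> D N"
    and "R0 > 0" and "0 \<le> \<gamma>" and "\<gamma> \<le> 1 / 96" and "0 < \<kappa>" and "\<kappa> < 1"
    and "reifenberg_flat \<Omega> R0 \<gamma>"
    and "separation_condition \<Omega> D N R0 \<kappa>"
    and "0 < l" and "l \<le> 1" and "strongly_elliptic l A"
    and "green_function \<Omega> D A G P"
    and "green_function \<Omega> D (adj_coeffs A) G' P'"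
    and "\<And>x y. x \<in> \<Omega> \<Longrightarrow> y \<in> \<Omega> \<Longrightarrow> x \<noteq> y \<Longrightarrow> G x y = transpose (G' y x)"
    and "f \<in> vec_of (Lq \<infinity> \<Omega>)" and "\<And>\<alpha>. F \<alpha> \<in> vec_of (Lq \<infinity> \<Omega>)"
    and "weak_solution \<Omega> D A f F (\<lambda>x. 0) u p"
  shows "AE y in lebesgue_on \<Omega>.
           u y = - (LINT x|lebesgue_on \<Omega>. G y x *v f x)
                 + (LINT x|lebesgue_on \<Omega>. (\<Sum>\<alpha>\<in>UNIV. wD_mat \<Omega> \<alpha> (\<lambda>z. G y z) x *v F \<alpha> x))"
proof -
  have \<Omega>: "\<Omega> \<in> sets lebesgue"
    using assms(1) by (simp add: bounded_domain_def)
  have "(\<lambda>x. 0) \<in> Lq \<infinity> \<Omega>"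
    using esssup_I[of "\<lambda>x. ereal \<bar>0\<bar>" "lebesgue_on \<Omega>" 0] by (auto simp: Lq_def)
  moreover have "adjoint_weak_solution \<Omega> D (adj_coeffs A) f F (\<lambda>x. 0) u p"
    using assms(18) by (simp add: adjoint_weak_solution_adj_coeffs)
  ultimately have rep: "AE y in lebesgue_on \<Omega>.
      u y = - (LINT x|lebesgue_on \<Omega>. transpose (G' x y) *v f x)
        + (LINT x|lebesgue_on \<Omega>.
             (\<Sum>\<alpha>\<in>UNIV. transpose (wD_mat \<Omega> \<alpha> (\<lambda>z. G' z y) x) *v F \<alpha> x))
        + (LINT x|lebesgue_on \<Omega>. 0 *\<^sub>R P' x y)"
    using assms(14)[unfolded green_function_def, THEN conjunct2, THEN conjunct2, rule_format,
      of f F "\<lambda>x. 0" u p] assms(16,17) by simp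
  have "AE y in lebesgue_on \<Omega>. y \<in> \<Omega>"
    by (rule AE_I2) simp
  with rep show ?thesis
  proof eventually_elim
    case (elim y)
    have ne: "AE x in lebesgue_on \<Omega>. x \<noteq> y"
      using \<Omega> AE_lborel_singleton[of y] by (auto simp: AE_restrict_space_iff intro: AE_completion)
    have "AE x in lebesgue_on \<Omega>. x \<in> \<Omega>"
      by (rule AE_I2) simp
    with ne have sym: "AE x in lebesgue_on \<Omega>. G y x = transpose (G' x y)"
      by eventually_elim (use assms(15) elim in auto)
    have "(LINT x|lebesgue_on \<Omega>. transpose (G' x y) *v f x) = (LINT x|lebesgue_on \<Omega>. G y x *v f x)"
      using sym by (intro integral_lebesgue_on_cong_AE[OF \<Omega>]) auto
    then show ?case
      using elim(1) by (simp add: wD_mat_transpose_cong_AE[OF \<Omega> sym])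
  qed
qed

end
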